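(* Consider the Glukhovsky-Dolzhansky system with real parameters $A,C,\sigma,R_a$: $$\dot x=Ayz+Cz-\sigma x,\qquad \dot y=-xz+R_a-y,\qquad \dot z=-z+xy .$$ (1) If $C=-2AR_a$ and $A<0$, then for every real $\alpha\ne0$ the change of variables $$x=\frac{X}{\alpha},\quad y=R_a-\frac{Z}{\alpha\sqrt{-A}},\quad z=\frac{Y}{\alpha\sqrt{-A}},\quad t=\alpha T$$ transforms the system into the Rabinovich system $$\frac{dX}{dT}=hY-v_1X+YZ,\quad \frac{dY}{dT}=hX-v_2Y-XZ,\quad \frac{dZ}{dT}=-v_3Z+XY$$ with parameters $(h,v_1,v_2,v_3)=(\alpha\sqrt{-A}\,R_a,\alpha\sigma,\alpha,\alpha)$. (2) If $\sigma=1$ and $A,C,R_a>0$, then the change of variables $$x=\frac{(AR_a+C)^{3/2}}{A\sqrt{R_a}}X,\quad y=R_a+\frac{(AR_a+C)Z}{A},\quad z=\frac{(AR_a+C)Y}{A},\quad t=\frac{T}{\sqrt{(AR_a+C)R_a}}$$ transforms the system into the 3D forced-damped system $$\frac{dX}{dT}=-aX+Y+YZ,\quad \frac{dY}{dT}=X-aY+bXZ,\quad \frac{dZ}{dT}=cZ-bXY$$ with parameters $(a,b,c)=\left(\frac{1}{\sqrt{(AR_a+C)R_a}},\ \frac{AR_a+C}{AR_a},\ -\frac{1}{\sqrt{(AR_a+C)R_a}}\right)$. (3) If $R_a=C=0$ and $A>0$, then the change of variables $$x=X,\quad y=\frac{Z}{\sqrt{A}},\quad z=-\frac{Y}{\sqrt{A}},\quad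 t=-T$$ transforms the system into the $D2$ vector field $$\frac{dX}{dT}=aX+YZ,\quad \frac{dY}{dT}=bY+XZ,\quad \frac{dZ}{dT}=Z-XY$$ with parameters $(a,b)=(\sigma,1)$. *)

theory Defs
  imports "HOL-Analysis.Analysis"
begin

fun glukhovsky_dolzhansky ::
  "real \<Rightarrow> real \<Rightarrow> real \<Rightarrow> real \<Rightarrow> real \<times> real \<times> real \<Rightarrow> real \<times> real \<times> real" where
  "glukhovsky_dolzhansky A C \<sigma> R (x, y, z) =
     (A * y * z + C * z - \<sigma> * x, - x * z + R - y, - z + x * y)"

fun rabinovich ::
  "real \<Rightarrow> real \<Rightarrow> real \<Rightarrow> real \<Rightarrow> real \<times> real \<times> real \<Rightarrow> real \<times> real \<times> real" where
  "rabinovich h v1 v2 v3 (X, Y, Z) =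
     (h * Y - v1 * X + Y * Z, h * X - v2 * Y - X * Z, - v3 * Z + X * Y)"

fun forced_damped ::
  "real \<Rightarrow> real \<Rightarrow> real \<Rightarrow> real \<times> real \<times> real \<Rightarrow> real \<times> real \<times> real" where
  "forced_damped a b c (X, Y, Z) =
     (- a * X + Y + Y * Z, X - a * Y + b * X * Z, c * Z - b * X * Y)"

fun D2_field ::
  "real \<Rightarrow> real \<Rightarrow> real \<times> real \<times> real \<Rightarrow> real \<times> real \<times> real" where
  "D2_field a b (X, Y, Z) = (a * X + Y * Z, b * Y + X * Z, Z - X * Y)"

text \<open>At an endpoint of the interval \<open>I\<close> the derivative is one-sided.\<close>

definition solution_on ::
  "('a::real_normed_vector \<Rightarrow> 'a) \<Rightarrow> (real \<Rightarrow> 'a) \<Rightarrow> real set \<Rightarrow> bool" where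
  "solution_on F u I \<longleftrightarrow>
     (\<forall>t\<in>I. (u has_vector_derivative F (u t)) (at t within I))"

definition diffeomorphism :: "('a::real_normed_vector \<Rightarrow> 'a) \<Rightarrow> bool" where
  "diffeomorphism f \<longleftrightarrow>
     bij f \<and> f differentiable_on UNIV \<and> inv f differentiable_on UNIV"

text \<open>
  The change of variables expresses the old state and the old time through the new ones:
  \<open>u = \<Phi> U\<close> and \<open>t = \<tau> T\<close>. It transforms the system \<open>F\<close>, with unknown \<open>u\<close> as a function
  of \<open>t\<close>, into the system \<open>G\<close>, with unknown \<open>U\<close> as a function of \<open>T\<close>, if any two curves
  related by it satisfy the one system exactly when they satisfy the other.
\<close>

definition transforms_into ::
  "('a::real_normed_vector \<Rightarrow> 'a) \<Rightarrow> (real \<Rightarrow> real) \<Rightarrow> ('a \<Rightarrow> 'a) \<Rightarrow> ('a \<Rightarrow> 'a) \<Rightarrow> bool" where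
  "transforms_into \<Phi> \<tau> F G \<longleftrightarrow>
     diffeomorphism \<Phi> \<and> diffeomorphism \<tau> \<and>
     (\<forall>I u U. is_interval I \<and> (\<forall>T\<in>I. u (\<tau> T) = \<Phi> (U T)) \<longrightarrow>
        (solution_on F u (\<tau> ` I) \<longleftrightarrow> solution_on G U I))"

end

(*
  An affine bijection u = p + L U together with the time scaling t = k T transforms F into G
  as soon as k F(p + L U) = L (G U), by the chain rule in both directions.  In each of the three
  cases this is an identity between explicit polynomials.
*)
theory Submission
  imports Defs
begin

text \<open>In finite dimension an injective linear endomorphism has a two-sided linear inverse
  \<open>M\<close>, so the inverse of the affine map is again affine, and both are
  differentiable.\<close>

lemma diffeomorphism_affine:
  fixes L :: "'a::euclidean_space \<Rightarrow> 'a"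
  assumes "linear L" and "inj L"
  shows "diffeomorphism (\<lambda>x. p + L x)"
proof -
  obtain M where M: "linear M" "\<And>x. M (L x) = x" "\<And>x. L (M x) = x"
    using linear_injective_isomorphism[OF assms] by blast
  have "inv (\<lambda>x. p + L x) = (\<lambda>y. M (y - p))"
    by (rule inv_equality) (simp_all add: M)
  moreover have "bij (\<lambda>x. p + L x)"
    by (rule o_bij[where g = "\<lambda>y. M (y - p)"]) (auto simp: M)
  moreover have "(\<lambda>x. p + L x) differentiable_on UNIV"
    by (intro differentiable_on_add differentiable_on_const linear_imp_differentiable_on assms)
  moreover have "(\<lambda>y. M (y - p)) differentiable_on UNIV"
    \<comment> \<open>Linearity splits \<open>M (y - p)\<close> into \<open>M y - M p\<close>, a
      linear map minus a constant.\<close>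
    unfolding linear_diff[OF M(1)]
    by (intro differentiable_on_diff differentiable_on_const linear_imp_differentiable_on M)
  ultimately show ?thesis
    by (simp add: diffeomorphism_def)
qed

text \<open>Each direction is the chain rule, once for multiplication by \<open>k\<close> and once
  for division by \<open>k\<close>. Working within \<open>I\<close> and its image carries one-sided
  derivatives along, also when \<open>k\<close> is negative and time is reversed.\<close>

lemma has_vector_derivative_scale_iff:
  fixes u :: "real \<Rightarrow> 'a::real_normed_vector"
  assumes "k \<noteq> 0"
  shows "((\<lambda>T. u (k * T)) has_vector_derivative k *\<^sub>R v) (at T within I) \<longleftrightarrow>
    (u has_vector_derivative v) (at (k * T) within (\<lambda>T. k * T) ` I)"
proof
  assume *: "((\<lambda>T. u (k * T)) has_vector_derivative k *\<^sub>R v) (at T within I)"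
  \<comment> \<open>The chain rule for division by \<open>k\<close> asks for a derivative within the
    rescaled image of the image of \<open>I\<close>, which is \<open>I\<close> again.\<close>
  have img: "(\<lambda>t. t / k) ` (\<lambda>T. k * T) ` I = I"
    using assms by (simp add: image_image)
  have "((\<lambda>t. t / k) has_vector_derivative 1 / k) (at (k * T) within (\<lambda>T. k * T) ` I)"
    by (auto intro!: derivative_eq_intros)
  from vector_diff_chain_within[OF this, of "\<lambda>T. u (k * T)" "k *\<^sub>R v"]
  show "(u has_vector_derivative v) (at (k * T) within (\<lambda>T. k * T) ` I)"
    using * assms by (simp add: img o_def)
next
  assume *: "(u has_vector_derivative v) (at (k * T) within (\<lambda>T. k * T) ` I)"
  have "((\<lambda>T. k * T) has_vector_derivative k) (at T within I)"
    by (auto intro!: derivative_eq_intros)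
  from vector_diff_chain_within[OF this *]
  show "((\<lambda>T. u (k * T)) has_vector_derivative k *\<^sub>R v) (at T within I)"
    by (simp add: o_def)
qed

text \<open>Linear maps on a Euclidean space are bounded and so commute with differentiation.
  Applying \<open>L\<close> gives one direction; subtracting \<open>p\<close> and applying the left
  inverse \<open>M\<close> gives the other.\<close>

lemma has_vector_derivative_affine_iff:
  fixes L :: "'a::euclidean_space \<Rightarrow> 'a"
  assumes "linear L" and "inj L"
  shows "((\<lambda>T. p + L (U T)) has_vector_derivative L V) (at T within I) \<longleftrightarrow>
    (U has_vector_derivative V) (at T within I)"
proof -
  obtain M where M: "linear M" "\<And>x. M (L x) = x"
    using linear_injective_isomorphism[OF assms] by blast
  have "bounded_linear L" "bounded_linear M"
    using assms(1) M(1) by (auto intro: linear_conv_bounded_linear[THEN iffD1])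
  note bl = this[THEN bounded_linear.has_vector_derivative]
  show ?thesis
  proof
    assume "((\<lambda>T. p + L (U T)) has_vector_derivative L V) (at T within I)"
    from has_vector_derivative_diff[OF this has_vector_derivative_const[of p]]
    have "((\<lambda>T. L (U T)) has_vector_derivative L V) (at T within I)"
      by simp
    from bl(2)[OF this] show "(U has_vector_derivative V) (at T within I)"
      by (simp add: M)
  next
    assume "(U has_vector_derivative V) (at T within I)"
    from has_vector_derivative_add[OF has_vector_derivative_const[of p] bl(1)[OF this]]
    show "((\<lambda>T. p + L (U T)) has_vector_derivative L V) (at T within I)"
      by simp
  qed
qed

lemma transforms_into_affine:
  fixes L :: "'a::euclidean_space \<Rightarrow> 'a"
  assumes \<Phi>: "\<And>U. \<Phi> U = p + L U" and L: "linear L" "inj L"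
    and \<tau>: "\<And>T. \<tau> T = k * T" and k: "k \<noteq> 0"
    and conj: "\<And>U. k *\<^sub>R F (\<Phi> U) = L (G U)"
  shows "transforms_into \<Phi> \<tau> F G"
proof -
  have \<Phi>': "\<Phi> = (\<lambda>U. p + L U)" and \<tau>': "\<tau> = (\<lambda>T. k * T)"
    using \<Phi> \<tau> by auto
  \<comment> \<open>The time scaling is the one-dimensional affine case with zero shift.\<close>
  have "diffeomorphism (\<lambda>T. 0 + k * T)"
    by (rule diffeomorphism_affine) (auto intro: injI simp: linear_iff algebra_simps k)
  then have "diffeomorphism \<tau>"
    by (simp add: \<tau>')
  moreover have "diffeomorphism \<Phi>"
    unfolding \<Phi>' by (rule diffeomorphism_affine[OF L])
  moreover have "solution_on F u (\<tau> ` I) \<longleftrightarrow> solution_on G U I"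
    if rel: "\<forall>T\<in>I. u (\<tau> T) = \<Phi> (U T)" for I u U
  proof -
    have "(u has_vector_derivative F (u (\<tau> T))) (at (\<tau> T) within \<tau> ` I) \<longleftrightarrow>
        (U has_vector_derivative G (U T)) (at T within I)" if "T \<in> I" for T
    proof -
      have "(u has_vector_derivative F (u (\<tau> T))) (at (\<tau> T) within \<tau> ` I) \<longleftrightarrow>
          ((\<lambda>T. u (\<tau> T)) has_vector_derivative k *\<^sub>R F (u (\<tau> T))) (at T within I)"
        unfolding \<tau>' by (rule has_vector_derivative_scale_iff[OF k, symmetric])
      \<comment> \<open>The two curves are known to agree only on \<open>I\<close>, which suffices
        for derivatives within \<open>I\<close> at a point of \<open>I\<close>; \<open>conj\<close>
        matches the derivative values.\<close>
      also have "\<dots> \<longleftrightarrow> ((\<lambda>T. \<Phi> (U T)) has_vector_derivative L (G (U T))) (at T within I)"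
        using rel that conj[of "U T"]
        by (auto intro: has_vector_derivative_transform[OF that, rotated])
      also have "\<dots> \<longleftrightarrow> (U has_vector_derivative G (U T)) (at T within I)"
        unfolding \<Phi>' by (rule has_vector_derivative_affine_iff[OF L])
      finally show ?thesis .
    qed
    then show ?thesis
      by (simp add: solution_on_def)
  qed
  ultimately show ?thesis
    by (simp add: transforms_into_def)
qed

text \<open>With \<open>C = - 2 * A * R\<close> the first equation contains A z (y - 2R). The shift
  of y by R turns this into -A z (R + Z / (\<alpha> s)), where s is the square root of -A; its two
  terms become hY and YZ.\<close>

lemma rabinovich_transform:
  fixes A \<sigma> R \<alpha> :: real
  assumes "A < 0" and "\<alpha> \<noteq> 0"
  shows "transforms_into
    (\<lambda>(X, Y, Z). (X / \<alpha>, R - Z / (\<alpha> * sqrt (- A)), Y / (\<alpha> * sqrt (- A))))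
    (\<lambda>T. \<alpha> * T)
    (glukhovsky_dolzhansky A (- 2 * A * R) \<sigma> R)
    (rabinovich (\<alpha> * sqrt (- A) * R) (\<alpha> * \<sigma>) \<alpha> \<alpha>)"
proof -
  \<comment> \<open>Replacing \<open>A\<close> by \<open>- (s * s)\<close> removes the root, so the
    conjugacy identity becomes rational in \<open>s\<close>.\<close>
  define s where "s = sqrt (- A)"
  have s: "s \<noteq> 0" "A = - (s * s)"
    using assms by (auto simp: s_def)
  show ?thesis
    unfolding s_def[symmetric]
  \<comment> \<open>The point \<open>(0, R, 0)\<close> is an equilibrium of the original system and
    is moved to the origin.\<close>
  proof (rule transforms_into_affine[where p = "(0, R, 0)" and k = \<alpha>
        and L = "\<lambda>(X, Y, Z). (X / \<alpha>, - Z / (\<alpha> * s), Y / (\<alpha> * s))"])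
    show "linear (\<lambda>(X, Y, Z). (X / \<alpha>, - Z / (\<alpha> * s), Y / (\<alpha> * s)))"
      by (auto simp: linear_iff add_divide_distrib diff_divide_distrib)
    show "inj (\<lambda>(X, Y, Z). (X / \<alpha>, - Z / (\<alpha> * s), Y / (\<alpha> * s)))"
      using assms s(1) by (auto intro!: injI)
  qed (use assms(2) s in \<open>auto simp: field_simps\<close>)
qed

text \<open>Put K = AR + C. After the shift y = R + K Z / A, the terms A y z + C z combine to K z (1
  + Z), which yields Y + YZ; the scalings of x and t normalize its coefficient to 1.\<close>

lemma forced_damped_transform:
  fixes A C R :: real
  assumes "A > 0" and "C > 0" and "R > 0"
  shows "transforms_into
    (\<lambda>(X, Y, Z). ((A * R + C) powr (3 / 2) / (A * sqrt R) * X,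
                  R + (A * R + C) * Z / A,
                  (A * R + C) * Y / A))
    (\<lambda>T. T / sqrt ((A * R + C) * R))
    (glukhovsky_dolzhansky A C 1 R)
    (forced_damped
      (1 / sqrt ((A * R + C) * R))
      ((A * R + C) / (A * R))
      (- (1 / sqrt ((A * R + C) * R))))"
proof -
  \<comment> \<open>In terms of the roots \<open>q\<close> and \<open>r\<close>, with
    \<open>C\<close> eliminated, the power 3/2 and all square roots disappear and the conjugacy
    identity is rational.\<close>
  define K where "K = A * R + C"
  define q where "q = sqrt K"
  define r where "r = sqrt R"
  have "K > 0"
    using assms by (simp add: K_def add_pos_pos)
  then have q: "q > 0" "K = q * q" and r: "r > 0" "R = r * r"
    using assms by (auto simp: q_def r_def)
  have "K powr (3 / 2) = K powr (1 + 1 / 2)"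
    by simp
  also have "\<dots> = q * q * q"
    unfolding powr_add using \<open>K > 0\<close> q by (simp add: powr_half_sqrt)
  finally have K32: "K powr (3 / 2) = q * q * q" .
  have sqrtKR: "sqrt (K * R) = q * r"
    by (simp add: real_sqrt_mult q_def r_def)
  have C: "C = q * q - A * (r * r)"
    using q(2) r(2) by (simp add: K_def)
  show ?thesis
    unfolding K_def[symmetric] K32 sqrtKR r_def[symmetric]
  proof (rule transforms_into_affine[where p = "(0, R, 0)" and k = "1 / (q * r)"
        and L = "\<lambda>(X, Y, Z). (q * q * q / (A * r) * X, K * Z / A, K * Y / A)"])
    show "linear (\<lambda>(X, Y, Z). (q * q * q / (A * r) * X, K * Z / A, K * Y / A))"
      by (auto simp: linear_iff algebra_simps add_divide_distrib)
    show "inj (\<lambda>(X, Y, Z). (q * q * q / (A * r) * X, K * Z / A, K * Y / A))"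
      using assms q(1) r(1) \<open>K > 0\<close> by (auto intro!: injI)
  qed (use assms(1) q r in \<open>auto simp: C field_simps\<close>)
qed

lemma D2_transform:
  fixes A \<sigma> :: real
  assumes "A > 0"
  shows "transforms_into
    (\<lambda>(X, Y, Z). (X, Z / sqrt A, - Y / sqrt A))
    (\<lambda>T. - T)
    (glukhovsky_dolzhansky A 0 \<sigma> 0)
    (D2_field \<sigma> 1)"
proof (rule transforms_into_affine[where p = 0 and k = "- 1"
      and L = "\<lambda>(X, Y, Z). (X, Z / sqrt A, - Y / sqrt A)"])
  show "linear (\<lambda>(X, Y, Z). (X, Z / sqrt A, - Y / sqrt A))"
    by (auto simp: linear_iff add_divide_distrib diff_divide_distrib)
  show "inj (\<lambda>(X, Y, Z). (X, Z / sqrt A, - Y / sqrt A))"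
    using assms by (auto intro!: injI)
qed (use assms in \<open>auto simp: field_simps\<close>)

theorem mainTheorem8:
  fixes A C \<sigma> R\<^sub>a :: real
  shows
    "(C = - 2 * A * R\<^sub>a \<and> A < 0 \<longrightarrow>
       (\<forall>\<alpha>::real. \<alpha> \<noteq> 0 \<longrightarrow>
         transforms_into
           (\<lambda>(X, Y, Z). (X / \<alpha>, R\<^sub>a - Z / (\<alpha> * sqrt (- A)), Y / (\<alpha> * sqrt (- A))))
           (\<lambda>T. \<alpha> * T)
           (glukhovsky_dolzhansky A C \<sigma> R\<^sub>a)
           (rabinovich (\<alpha> * sqrt (- A) * R\<^sub>a) (\<alpha> * \<sigma>) \<alpha> \<alpha>)))
     \<and>
     (\<sigma> = 1 \<and> A > 0 \<and> C > 0 \<and> R\<^sub>a > 0 \<longrightarrow>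
       transforms_into
         (\<lambda>(X, Y, Z). ((A * R\<^sub>a + C) powr (3 / 2) / (A * sqrt R\<^sub>a) * X,
                       R\<^sub>a + (A * R\<^sub>a + C) * Z / A,
                       (A * R\<^sub>a + C) * Y / A))
         (\<lambda>T. T / sqrt ((A * R\<^sub>a + C) * R\<^sub>a))
         (glukhovsky_dolzhansky A C \<sigma> R\<^sub>a)
         (forced_damped
           (1 / sqrt ((A * R\<^sub>a + C) * R\<^sub>a))
           ((A * R\<^sub>a + C) / (A * R\<^sub>a))
           (- (1 / sqrt ((A * R\<^sub>a + C) * R\<^sub>a)))))
     \<and>
     (R\<^sub>a = 0 \<and> C = 0 \<and> A > 0 \<longrightarrow>
       transforms_into
         (\<lambda>(X, Y, Z). (X, Z / sqrt A, - Y / sqrt A))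
         (\<lambda>T. - T)
         (glukhovsky_dolzhansky A C \<sigma> R\<^sub>a)
         (D2_field \<sigma> 1))"
  using rabinovich_transform forced_damped_transform D2_transform by blast

end
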